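(* Fix a mechanism $\mathcal M=(X,P)$, an instance $I$, a bidder $i$, a threshold function $T_i:\mathcal X_i\times\mathcal A_{-i}\to\mathbb R_{\ge0}$, an optimal liquid welfare profile $\chi^*$, and $\lambda>0$, $\mu\ge0$. If bidder $i$ is conservatively $(\lambda,\mu)$-smooth, then bidder $i$ is budget-feasible $(\lambda,\mu)$-smooth.
   Context: An instance $I$ consists of bidders $N=[n]$, $n\ge2$, where bidder $i$ has an action set $\mathcal A_i$, a finite set of allocations $\mathcal X_i$, a valuation $v_i:\mathcal X_i\to\mathbb R_{\ge0}$ and a budget $B_i\in(0,\infty]$; $\mathcal A=\prod_i\mathcal A_i$, and $\mathcal X\subseteq\prod_i\mathcal X_i$ is the set of feasible allocation profiles. A mechanism $\mathcal M=(X,P)$ consists of $X:\mathcal A\to\mathcal X$ and $P:\mathcal A\to\mathbb R_{\ge0}^n$. Each bidder has an opt-out action $\emptyset_i\in\mathcal A_i$ with $P_i(\emptyset_i,a_{-i})=0$ for all $a_{-i}$. Utility: $u_i(a)=v_i(X_i(a))-P_i(a)$. $\Delta(S)$ is the set of probability distributions on $S$. For a pure profile $a_{-i}$, $\mathcal C_i(a_{-i})$ is the set of $A_i'\in\Delta(\mathcal A_i)$ with $\mathbb E_{a_i'\sim A_i'}[P_i(a_i',a_{-i})]\le B_i$. For $\chi\in\Delta(\mathcal X)$ with marginals $\chi_i$, $\hat v_i(\chi_i)=\min\{\mathbb E_{x_i\sim\chi_i}[v_i(x_i)],B_i\}$; an optimal liquid welfare profile $\chi^*$ is a maximizer of $\sum_i\hat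 v_i(\chi_i)$ over $\Delta(\mathcal X)$. Bidder $i$ is conservatively $(\lambda,\mu)$-smooth if for every $x_i\in\mathcal X_i$ there is $A_i'\in\Delta(\mathcal A_i)$ such that for every pure profile $a\in\mathcal A$, $$\mathbb E_{a_i'\sim A_i'}[u_i(a_i',a_{-i})]\ge\lambda v_i(x_i)-\mu T_i(x_i,a_{-i}),$$ and $P_i(a_i',a_{-i})\le v_i(x_i)$ for all $a_i'\in\mathrm{supp}(A_i')$ and all $a_{-i}$. Bidder $i$ is budget-feasible $(\lambda,\mu)$-smooth if there is $A_i'\in\Delta(\mathcal A_i)$ such that for every pure profile $a\in\mathcal A$ we have $A_i'\in\mathcal C_i(a_{-i})$ and $$\mathbb E_{a_i'\sim A_i'}[u_i(a_i',a_{-i})]\ge\lambda\hat v_i(\chi_i^* )-\mu\,\mathbb E_{x_i\sim\chi_i^*}[T_i(x_i,a_{-i})].$$ *)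

theory Defs
  imports "HOL-Probability.Probability"
begin

section \<open>Probability distributions on an action space\<close>

text \<open>
  An action set carries a topology, which only serves to give meaning to ``distribution on the
  action set'' and to ``support''.  A bare set is covered by its discrete topology.
\<close>

definition borel_sigma :: "'a topology \<Rightarrow> 'a measure" where
  "borel_sigma \<tau> = sigma (topspace \<tau>) {U. openin \<tau> U}"

definition dist_supp :: "'a topology \<Rightarrow> 'a measure \<Rightarrow> 'a set" where
  "dist_supp \<tau> D = {x \<in> topspace \<tau>. \<forall>U. openin \<tau> U \<and> x \<in> U \<longrightarrow> emeasure D U > 0}"

text \<open>
  Borel probability measures carried by their support.  The last condition is automatic for second
  countable topologies (e.g. bids in a subset of Euclidean space).  For the discrete topology the
  support is the set of atoms, so that exactly the discrete distributions on the set remain.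
\<close>

definition Delta :: "'a topology \<Rightarrow> 'a measure set" where
  "Delta \<tau> = {D. sets D = sets (borel_sigma \<tau>) \<and> prob_space D \<and> emeasure D (dist_supp \<tau> D) = 1}"

text \<open>
  The expectation is extended-real valued: utilities are bounded above but payments need not be
  integrable, and the Bochner integral would assign the value 0 to a non-integrable utility whose
  expectation is \<open>-\<infinity>\<close>.
\<close>

definition expect :: "'a measure \<Rightarrow> ('a \<Rightarrow> real) \<Rightarrow> ereal" where
  "expect D f =
     enn2ereal (\<integral>\<^sup>+ x. ennreal (f x) \<partial>D) - enn2ereal (\<integral>\<^sup>+ x. ennreal (- f x) \<partial>D)"


section \<open>Instances and mechanisms\<close>

record ('a, 'x) auction_instance =
  num_bidders :: nat
  action_top :: "nat \<Rightarrow> 'a topology"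
  allocs :: "nat \<Rightarrow> 'x set"
  feasible :: "(nat \<Rightarrow> 'x) set"
  valuation :: "nat \<Rightarrow> 'x \<Rightarrow> real"
  budget :: "nat \<Rightarrow> ereal"

record ('a, 'x) mechanism =
  outcome :: "(nat \<Rightarrow> 'a) \<Rightarrow> nat \<Rightarrow> 'x"
  payment :: "(nat \<Rightarrow> 'a) \<Rightarrow> nat \<Rightarrow> real"

definition bidders :: "('a, 'x) auction_instance \<Rightarrow> nat set" where
  "bidders I = {1..num_bidders I}"

definition actions :: "('a, 'x) auction_instance \<Rightarrow> nat \<Rightarrow> 'a set" where
  "actions I i = topspace (action_top I i)"

definition profiles :: "('a, 'x) auction_instance \<Rightarrow> (nat \<Rightarrow> 'a) set" where
  "profiles I = (\<Pi>\<^sub>E j\<in>bidders I. actions I j)"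

text \<open>
  A profile \<open>b\<close> of the bidders other than \<open>i\<close> is completed by \<open>b(i := a')\<close>; the profile of the
  others induced by a full profile \<open>a\<close> is \<open>others I i a\<close>.
\<close>

definition other_profiles :: "('a, 'x) auction_instance \<Rightarrow> nat \<Rightarrow> (nat \<Rightarrow> 'a) set" where
  "other_profiles I i = (\<Pi>\<^sub>E j\<in>bidders I - {i}. actions I j)"

definition others :: "('a, 'x) auction_instance \<Rightarrow> nat \<Rightarrow> (nat \<Rightarrow> 'a) \<Rightarrow> nat \<Rightarrow> 'a" where
  "others I i a = restrict a (bidders I - {i})"

definition is_instance :: "('a, 'x) auction_instance \<Rightarrow> bool" where
  "is_instance I \<longleftrightarrow>
     num_bidders I \<ge> 2 \<and>
     (\<forall>i\<in>bidders I. finite (allocs I i)) \<and>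
     (\<forall>i\<in>bidders I. \<forall>x\<in>allocs I i. 0 \<le> valuation I i x) \<and>
     (\<forall>i\<in>bidders I. 0 < budget I i) \<and>
     feasible I \<subseteq> (\<Pi>\<^sub>E i\<in>bidders I. allocs I i)"

text \<open>
  The two measurability conditions make the expectations over a bidder's own mixed action
  meaningful; they hold trivially if the action sets carry the discrete topology.
\<close>

definition is_mechanism :: "('a, 'x) auction_instance \<Rightarrow> ('a, 'x) mechanism \<Rightarrow> bool" where
  "is_mechanism I M \<longleftrightarrow>
     (\<forall>a\<in>profiles I. outcome M a \<in> feasible I) \<and>
     (\<forall>a\<in>profiles I. \<forall>i\<in>bidders I. 0 \<le> payment M a i) \<and>
     (\<forall>i\<in>bidders I. \<exists>e\<in>actions I i. \<forall>b\<in>other_profiles I i. payment M (b(i := e)) i = 0) \<and>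
     (\<forall>i\<in>bidders I. \<forall>b\<in>other_profiles I i.
        (\<lambda>a'. outcome M (b(i := a')) i) \<in> borel_sigma (action_top I i) \<rightarrow>\<^sub>M count_space (allocs I i) \<and>
        (\<lambda>a'. payment M (b(i := a')) i) \<in> borel_measurable (borel_sigma (action_top I i)))"

definition utility :: "('a, 'x) auction_instance \<Rightarrow> ('a, 'x) mechanism \<Rightarrow> nat \<Rightarrow> (nat \<Rightarrow> 'a) \<Rightarrow> real" where
  "utility I M i a = valuation I i (outcome M a i) - payment M a i"

definition budget_feasible_actions ::
  "('a, 'x) auction_instance \<Rightarrow> ('a, 'x) mechanism \<Rightarrow> nat \<Rightarrow> (nat \<Rightarrow> 'a) \<Rightarrow> 'a measure set" where
  "budget_feasible_actions I M i b =
     {D \<in> Delta (action_top I i). expect D (\<lambda>a'. payment M (b(i := a')) i) \<le> budget I i}"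

definition is_threshold :: "('a, 'x) auction_instance \<Rightarrow> nat \<Rightarrow> ('x \<Rightarrow> (nat \<Rightarrow> 'a) \<Rightarrow> real) \<Rightarrow> bool" where
  "is_threshold I i T \<longleftrightarrow> (\<forall>x\<in>allocs I i. \<forall>b\<in>other_profiles I i. 0 \<le> T x b)"


section \<open>Liquid welfare\<close>

text \<open>
  There are only finitely many feasible allocation profiles, so distributions over them are
  probability mass functions.
\<close>

definition alloc_dists :: "('a, 'x) auction_instance \<Rightarrow> (nat \<Rightarrow> 'x) pmf set" where
  "alloc_dists I = {chi. set_pmf chi \<subseteq> feasible I}"

definition marginal :: "(nat \<Rightarrow> 'x) pmf \<Rightarrow> nat \<Rightarrow> 'x pmf" where
  "marginal chi i = map_pmf (\<lambda>x. x i) chi"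

definition liquid_value :: "('a, 'x) auction_instance \<Rightarrow> nat \<Rightarrow> 'x pmf \<Rightarrow> ereal" where
  "liquid_value I i \<xi> = min (ereal (measure_pmf.expectation \<xi> (valuation I i))) (budget I i)"

definition liquid_welfare :: "('a, 'x) auction_instance \<Rightarrow> (nat \<Rightarrow> 'x) pmf \<Rightarrow> ereal" where
  "liquid_welfare I chi = (\<Sum>i\<in>bidders I. liquid_value I i (marginal chi i))"

definition optimal_liquid_welfare :: "('a, 'x) auction_instance \<Rightarrow> (nat \<Rightarrow> 'x) pmf \<Rightarrow> bool" where
  "optimal_liquid_welfare I chi \<longleftrightarrow>
     chi \<in> alloc_dists I \<and> (\<forall>chi'\<in>alloc_dists I. liquid_welfare I chi' \<le> liquid_welfare I chi)"


section \<open>Smoothness\<close>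

definition conservatively_smooth ::
  "('a, 'x) auction_instance \<Rightarrow> ('a, 'x) mechanism \<Rightarrow> nat \<Rightarrow> ('x \<Rightarrow> (nat \<Rightarrow> 'a) \<Rightarrow> real)
     \<Rightarrow> real \<Rightarrow> real \<Rightarrow> bool" where
  "conservatively_smooth I M i T lam mu \<longleftrightarrow>
     (\<forall>x\<in>allocs I i. \<exists>D\<in>Delta (action_top I i).
        (\<forall>a\<in>profiles I.
           expect D (\<lambda>a'. utility I M i ((others I i a)(i := a')))
             \<ge> ereal (lam * valuation I i x - mu * T x (others I i a))) \<and>
        (\<forall>a'\<in>dist_supp (action_top I i) D. \<forall>b\<in>other_profiles I i.
           payment M (b(i := a')) i \<le> valuation I i x))"

definition budget_feasible_smooth ::
  "('a, 'x) auction_instance \<Rightarrow> ('a, 'x) mechanism \<Rightarrow> nat \<Rightarrow> ('x \<Rightarrow> (nat \<Rightarrow> 'a) \<Rightarrow> real)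
     \<Rightarrow> (nat \<Rightarrow> 'x) pmf \<Rightarrow> real \<Rightarrow> real \<Rightarrow> bool" where
  "budget_feasible_smooth I M i T chi lam mu \<longleftrightarrow>
     (\<exists>D\<in>Delta (action_top I i).
        \<forall>a\<in>profiles I.
          D \<in> budget_feasible_actions I M i (others I i a) \<and>
          expect D (\<lambda>a'. utility I M i ((others I i a)(i := a')))
            \<ge> ereal lam * liquid_value I i (marginal chi i)
               - ereal (mu * measure_pmf.expectation (marginal chi i) (\<lambda>x. T x (others I i a))))"

end

(* Mix the conservative deviations for the allocations x_i according to chi_i; the expected payment
   is then at most the expected value V. If V exceeds the budget B, play this mixture only with
   probability q = B / V and opt out otherwise: the expected payment drops to at most q V = B, and,
   since opting out never yields negative utility, the utility guarantee becomes
   q (lam V - mu E[T]) >= lam B - mu E[T], using q <= 1 and T >= 0. *)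
theory Submission
  imports Defs
begin

section \<open>Borel sets, supports and point masses\<close>

lemma space_borel_sigma [simp]: "space (borel_sigma \<tau>) = topspace \<tau>"
  unfolding borel_sigma_def by (rule space_measure_of) (auto dest: openin_subset)

lemma openin_imp_sets_borel_sigma: "openin \<tau> U \<Longrightarrow> U \<in> sets (borel_sigma \<tau>)"
  unfolding borel_sigma_def by (subst sets_measure_of) (auto dest: openin_subset)

text \<open>A point lies outside the support exactly when some open null set contains it, so the
  complement is a union of open sets. This is what makes the support measurable.\<close>

lemma closedin_dist_supp: "closedin \<tau> (dist_supp \<tau> D)"
proof -
  have "topspace \<tau> - dist_supp \<tau> D = \<Union> {U. openin \<tau> U \<and> emeasure D U = 0}"
    by (auto simp: dist_supp_def dest: openin_subset)
  moreover have "openin \<tau> \<dots>"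
    by (rule openin_Union) auto
  ultimately show ?thesis
    by (simp add: closedin_def dist_supp_def)
qed

lemma dist_supp_in_sets: "dist_supp \<tau> D \<in> sets (borel_sigma \<tau>)"
proof -
  have "topspace \<tau> - (topspace \<tau> - dist_supp \<tau> D) \<in> sets (borel_sigma \<tau>)"
    using sets.compl_sets[OF openin_imp_sets_borel_sigma[of \<tau> "topspace \<tau> - dist_supp \<tau> D"]]
      closedin_dist_supp[of \<tau> D] by (simp add: closedin_def)
  then show ?thesis
    by (simp add: double_diff dist_supp_def)
qed

lemma Delta_prob_space: "D \<in> Delta \<tau> \<Longrightarrow> prob_space D"
  and Delta_sets: "D \<in> Delta \<tau> \<Longrightarrow> sets D = sets (borel_sigma \<tau>)"
  by (simp_all add: Delta_def)

lemma Delta_measurable: "D \<in> Delta \<tau> \<Longrightarrow> measurable D N = measurable (borel_sigma \<tau>) N"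
  by (rule measurable_cong_sets[OF Delta_sets refl])

text \<open>Lets bounds known pointwise on the support, such as the payment bound of conservative
  smoothness, be used as almost sure bounds under the integral.\<close>

lemma Delta_AE_supp:
  assumes "D \<in> Delta \<tau>"
  shows "AE x in D. x \<in> dist_supp \<tau> D"
proof -
  interpret prob_space D
    using assms by (rule Delta_prob_space)
  show ?thesis
    by (rule AE_prob_1) (use assms in \<open>simp add: Delta_def measure_def\<close>)
qed

text \<open>Every open set around \<open>e\<close> has mass 1 under the point mass, so
  \<open>e\<close> is in the support, and the support therefore has full mass. This provides opting
  out as a mixed action.\<close>

lemma return_in_Delta:
  assumes "e \<in> topspace \<tau>"
  shows "return (borel_sigma \<tau>) e \<in> Delta \<tau>"
proof -
  have "e \<in> dist_supp \<tau> (return (borel_sigma \<tau>) e)"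
    using assms by (auto simp: dist_supp_def openin_imp_sets_borel_sigma)
  then show ?thesis
    using assms by (simp add: Delta_def prob_space_return dist_supp_in_sets)
qed

section \<open>Mixtures of distributions and their integrals\<close>

lemma Delta_kernel:
  assumes "\<And>x. K x \<in> Delta \<tau>"
  shows "K \<in> measurable (measure_pmf p) (subprob_algebra (borel_sigma \<tau>))"
  using Delta_sets[OF assms] prob_space_imp_subprob_space[OF Delta_prob_space[OF assms]]
  by (auto simp: space_subprob_algebra)

text \<open>The support condition is the point at issue. Each component of positive weight has its
  support inside that of the mixture, so it gives full mass to the latter, and so does their
  average.\<close>

lemma bind_pmf_in_Delta:
  assumes K: "\<And>x. K x \<in> Delta \<tau>"
  shows "measure_pmf p \<bind> K \<in> Delta \<tau>"
proof -
  let ?D = "measure_pmf p \<bind> K"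
  note ker = Delta_kernel[of K, OF K, of p]
  have sets: "sets ?D = sets (borel_sigma \<tau>)"
    by (rule sets_bind_measurable[OF ker]) simp
  have prob: "prob_space ?D"
    using K by (intro measure_pmf.prob_space_bind[OF _ ker] AE_I2) (rule Delta_prob_space)
  have "dist_supp \<tau> (K x) \<subseteq> dist_supp \<tau> ?D" if x: "x \<in> set_pmf p" for x
  proof -
    have "emeasure ?D U > 0" if U: "openin \<tau> U" "emeasure (K x) U > 0" for U
    proof -
      have "emeasure ?D U = (\<integral>\<^sup>+ y. emeasure (K y) U \<partial>measure_pmf p)"
        using U by (intro emeasure_bind[OF _ ker]) (auto intro: openin_imp_sets_borel_sigma)
      \<comment> \<open>The single point \<open>x\<close> already has positive weight, so the
        integrand is not almost everywhere zero and the mixture charges \<open>U\<close>.\<close>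
      moreover have "\<not> (AE y in measure_pmf p. emeasure (K y) U = 0)"
        using x U by (auto simp: AE_measure_pmf_iff intro!: bexI[of _ x])
      ultimately show ?thesis
        by (simp add: nn_integral_0_iff_AE zero_less_iff_neq_zero)
    qed
    then show ?thesis
      by (auto simp: dist_supp_def)
  qed
  then have "AE x in measure_pmf p. AE y in K x. y \<in> dist_supp \<tau> ?D"
    by (auto simp: AE_measure_pmf_iff intro: AE_mp[OF Delta_AE_supp[OF K] AE_I2])
  then have "AE y in ?D. y \<in> dist_supp \<tau> ?D"
    by (subst AE_bind[OF ker]) (auto intro: pred_sets2[OF dist_supp_in_sets])
  then have "emeasure ?D (dist_supp \<tau> ?D) = 1"
    using prob_space.AE_in_set_eq_1[OF prob, of "dist_supp \<tau> ?D"] dist_supp_in_sets[of \<tau> ?D]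
    by (simp add: sets prob_space_imp_subprob_space prob finite_measure.emeasure_eq_measure
        prob_space.finite_measure)
  then show ?thesis
    using sets prob by (simp add: Delta_def)
qed

text \<open>Since \<open>f\<close> may change sign and be unbounded, positive and negative parts are
  averaged separately. A finite \<open>set_pmf p\<close> keeps both averages finite, so that they
  can be subtracted.\<close>

lemma
  fixes f :: "'a \<Rightarrow> real"
  assumes K: "\<And>x. K x \<in> Delta \<tau>" and fin: "finite (set_pmf p)"
    and f: "f \<in> borel_measurable (borel_sigma \<tau>)"
    and int: "\<And>x. x \<in> set_pmf p \<Longrightarrow> integrable (K x) f"
  shows integrable_bind_pmf: "integrable (measure_pmf p \<bind> K) f"
    and integral_bind_pmf:
      "(\<integral>y. f y \<partial>(measure_pmf p \<bind> K)) = (\<integral>x. (\<integral>y. f y \<partial>K x) \<partial>measure_pmf p)"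
proof -
  let ?D = "measure_pmf p \<bind> K"
  note ker = Delta_kernel[of K, OF K, of p]
  \<comment> \<open>As \<open>ennreal\<close> sends negative reals to 0, the instances
    \<open>f\<close> and \<open>- f\<close> of \<open>g\<close> yield the positive and the negative
    part of \<open>f\<close>.\<close>
  have nn: "(\<integral>\<^sup>+ y. ennreal (g y) \<partial>?D)
      = ennreal (\<integral>x. enn2real (\<integral>\<^sup>+ y. ennreal (g y) \<partial>K x) \<partial>measure_pmf p)"
    if g: "g \<in> borel_measurable (borel_sigma \<tau>)"
      "\<And>x. x \<in> set_pmf p \<Longrightarrow> (\<integral>\<^sup>+ y. ennreal (g y) \<partial>K x) \<noteq> \<infinity>" for g :: "'a \<Rightarrow> real"
  proof -
    have "(\<integral>\<^sup>+ y. ennreal (g y) \<partial>?D) = (\<integral>\<^sup>+ x. \<integral>\<^sup>+ y. ennreal (g y) \<partial>K x \<partial>measure_pmf p)"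
      using g by (intro nn_integral_bind[OF _ ker]) auto
    also have "\<dots> = (\<integral>\<^sup>+ x. ennreal (enn2real (\<integral>\<^sup>+ y. ennreal (g y) \<partial>K x)) \<partial>measure_pmf p)"
      using g(2) by (intro nn_integral_cong_AE) (auto simp: AE_measure_pmf_iff less_top)
    also have "\<dots> = ennreal (\<integral>x. enn2real (\<integral>\<^sup>+ y. ennreal (g y) \<partial>K x) \<partial>measure_pmf p)"
      using fin by (intro nn_integral_eq_integral integrable_measure_pmf_finite) auto
    finally show ?thesis .
  qed
  note pos = nn[OF f] and neg = nn[of "\<lambda>y. - f y"]
  have fin_parts: "(\<integral>\<^sup>+ y. ennreal (f y) \<partial>K x) \<noteq> \<infinity>" "(\<integral>\<^sup>+ y. ennreal (- f y) \<partial>K x) \<noteq> \<infinity>"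
    if "x \<in> set_pmf p" for x
    using int[OF that] unfolding real_integrable_def by auto
  have f': "f \<in> borel_measurable ?D"
    using f by (simp add: Delta_measurable[OF bind_pmf_in_Delta[of K, OF K]])
  show *: "integrable ?D f"
    unfolding real_integrable_def using f f' fin_parts pos neg by simp
  have "(\<integral>y. f y \<partial>?D)
      = (\<integral>x. enn2real (\<integral>\<^sup>+ y. ennreal (f y) \<partial>K x) \<partial>measure_pmf p)
        - (\<integral>x. enn2real (\<integral>\<^sup>+ y. ennreal (- f y) \<partial>K x) \<partial>measure_pmf p)"
    using real_lebesgue_integral_def[OF *] f fin_parts pos neg by simp
  also have "\<dots> = (\<integral>x. enn2real (\<integral>\<^sup>+ y. ennreal (f y) \<partial>K x)
      - enn2real (\<integral>\<^sup>+ y. ennreal (- f y) \<partial>K x) \<partial>measure_pmf p)"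
    using fin by (intro Bochner_Integration.integral_diff[symmetric] integrable_measure_pmf_finite)
  also have "\<dots> = (\<integral>x. (\<integral>y. f y \<partial>K x) \<partial>measure_pmf p)"
    using int by (intro integral_cong_AE) (auto simp: AE_measure_pmf_iff real_lebesgue_integral_def)
  finally show "(\<integral>y. f y \<partial>?D) = (\<integral>x. (\<integral>y. f y \<partial>K x) \<partial>measure_pmf p)" .
qed

section \<open>Passing from extended-real expectations to real integrals\<close>

lemma expect_eq_integral:
  assumes "integrable D f"
  shows "expect D f = ereal (\<integral>x. f x \<partial>D)"
  using assms real_lebesgue_integral_def[OF assms] by (elim integrableE) (simp add: expect_def)

lemma fun_upd_in_profiles:
  assumes "i \<in> bidders I" "b \<in> other_profiles I i" "a' \<in> actions I i"
  shows "b(i := a') \<in> profiles I"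
  using PiE_fun_upd[of a' "actions I" i b "bidders I - {i}"] assms
  by (simp add: other_profiles_def profiles_def insert_absorb)

lemma others_in_other_profiles:
  assumes "a \<in> profiles I"
  shows "others I i a \<in> other_profiles I i"
  using assms by (auto simp: others_def other_profiles_def profiles_def)

text \<open>Payments lie between 0 and \<open>c\<close> on the support, hence almost surely, and the
  outcome takes only finitely many values. So \<open>expect\<close> reduces to a real integral for
  payment and utility alike.\<close>

lemma
  assumes inst: "is_instance I" and mech: "is_mechanism I M" and i: "i \<in> bidders I"
    and b: "b \<in> other_profiles I i" and D: "D \<in> Delta (action_top I i)"
    and bound: "\<And>a'. a' \<in> dist_supp (action_top I i) D \<Longrightarrow> payment M (b(i := a')) i \<le> c"
  shows integrable_payment: "integrable D (\<lambda>a'. payment M (b(i := a')) i)"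
    and integral_payment_le: "(\<integral>a'. payment M (b(i := a')) i \<partial>D) \<le> c"
    and integrable_utility: "integrable D (\<lambda>a'. utility I M i (b(i := a')))"
proof -
  interpret prob_space D
    using D by (rule Delta_prob_space)
  have meas: "(\<lambda>a'. outcome M (b(i := a')) i) \<in> D \<rightarrow>\<^sub>M count_space (allocs I i)"
    "(\<lambda>a'. payment M (b(i := a')) i) \<in> borel_measurable D"
    using mech i b by (simp_all add: Delta_measurable[OF D] is_mechanism_def)
  have pay: "AE a' in D. 0 \<le> payment M (b(i := a')) i \<and> payment M (b(i := a')) i \<le> c"
    using Delta_AE_supp[OF D]
  proof eventually_elim
    case (elim a')
    then have "b(i := a') \<in> profiles I"
      by (intro fun_upd_in_profiles i b) (simp add: dist_supp_def actions_def)
    with elim show ?case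
      using mech i bound by (auto simp: is_mechanism_def)
  qed
  show int_pay: "integrable D (\<lambda>a'. payment M (b(i := a')) i)"
    by (rule integrable_const_bound[where B = c]) (use pay meas in \<open>auto elim: eventually_mono\<close>)
  show "(\<integral>a'. payment M (b(i := a')) i \<partial>D) \<le> c"
    by (rule integral_le_const[OF int_pay]) (use pay in \<open>auto elim: eventually_mono\<close>)
  have fin: "finite (allocs I i)"
    using inst i by (simp add: is_instance_def)
  \<comment> \<open>The sum of all absolute valuations is a crude uniform bound, finite because
    \<open>allocs I i\<close> is finite.\<close>
  have "integrable D (\<lambda>a'. valuation I i (outcome M (b(i := a')) i))"
  proof (rule integrable_const_bound[where B = "\<Sum>x\<in>allocs I i. \<bar>valuation I i x\<bar>"])
    show "AE a' in D. norm (valuation I i (outcome M (b(i := a')) i))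
        \<le> (\<Sum>x\<in>allocs I i. \<bar>valuation I i x\<bar>)"
      using measurable_space[OF meas(1)] fin
      by (intro AE_I2) (auto intro!: member_le_sum[of _ _ "\<lambda>x. \<bar>valuation I i x\<bar>"])
    show "(\<lambda>a'. valuation I i (outcome M (b(i := a')) i)) \<in> borel_measurable D"
      by (rule measurable_compose[OF meas(1)]) simp
  qed
  then show "integrable D (\<lambda>a'. utility I M i (b(i := a')))"
    unfolding utility_def using int_pay by (rule Bochner_Integration.integrable_diff)
qed

lemma payment_measurable:
  assumes "is_mechanism I M" "i \<in> bidders I" "b \<in> other_profiles I i"
  shows "(\<lambda>a'. payment M (b(i := a')) i) \<in> borel_measurable (borel_sigma (action_top I i))"
  using assms by (simp add: is_mechanism_def)

lemma utility_measurable: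
  assumes "is_mechanism I M" "i \<in> bidders I" "b \<in> other_profiles I i"
  shows "(\<lambda>a'. utility I M i (b(i := a'))) \<in> borel_measurable (borel_sigma (action_top I i))"
proof -
  have "(\<lambda>a'. outcome M (b(i := a')) i)
      \<in> borel_sigma (action_top I i) \<rightarrow>\<^sub>M count_space (allocs I i)"
    using assms by (simp add: is_mechanism_def)
  then have "(\<lambda>a'. valuation I i (outcome M (b(i := a')) i))
      \<in> borel_measurable (borel_sigma (action_top I i))"
    by (rule measurable_compose) simp
  then show ?thesis
    unfolding utility_def using payment_measurable[OF assms] by (rule borel_measurable_diff)
qed

text \<open>Treats slack and binding budgets uniformly: \<open>q\<close> is 1 when the budget is
  slack, in particular infinite, and budget over value otherwise, where the value is positive
  because it exceeds the budget.\<close>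

lemma min_ereal_eq_scaled:
  fixes v :: real and B :: ereal
  assumes "0 \<le> v" "0 < B"
  obtains q :: real where "0 \<le> q" "q \<le> 1" "min (ereal v) B = ereal (q * v)"
proof (cases "ereal v \<le> B")
  case True
  then show thesis
    by (intro that[of 1]) (auto simp: min_def)
next
  case False
  with assms obtain r where "B = ereal r" "0 < r" "r < v"
    by (cases B) auto
  then show thesis
    by (intro that[of "r / v"]) (auto simp: min_def)
qed

section \<open>Construction of the budget-feasible deviation\<close>

theorem theoremC1:
  fixes I :: "('a, 'x) auction_instance"
    and M :: "('a, 'x) mechanism"
    and i :: nat
    and T :: "'x \<Rightarrow> (nat \<Rightarrow> 'a) \<Rightarrow> real"
    and chi :: "(nat \<Rightarrow> 'x) pmf"
    and lam mu :: real
  assumes "is_instance I"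
    and "is_mechanism I M"
    and "i \<in> bidders I"
    and "is_threshold I i T"
    and "optimal_liquid_welfare I chi"
    and "lam > 0"
    and "mu \<ge> 0"
    and "conservatively_smooth I M i T lam mu"
  shows "budget_feasible_smooth I M i T chi lam mu"
proof -
  note inst = assms(1) and mech = assms(2) and i = assms(3)
  let ?\<tau> = "action_top I i" and ?v = "valuation I i"
  define \<xi> where "\<xi> = marginal chi i"
  have fin_allocs: "finite (allocs I i)" and v_nonneg: "\<And>x. x \<in> allocs I i \<Longrightarrow> 0 \<le> ?v x"
    using inst i by (auto simp: is_instance_def)
  have supp: "set_pmf \<xi> \<subseteq> allocs I i"
    using inst i assms(5)
    by (fastforce simp: \<xi>_def marginal_def optimal_liquid_welfare_def alloc_dists_def is_instance_def)
  then have fin: "finite (set_pmf \<xi>)"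
    using fin_allocs finite_subset by blast
  obtain e where e: "e \<in> actions I i"
    and e_pay: "\<And>b. b \<in> other_profiles I i \<Longrightarrow> payment M (b(i := e)) i = 0"
    using mech i unfolding is_mechanism_def by blast
  define R where "R = return (borel_sigma ?\<tau>) e"
  have R: "R \<in> Delta ?\<tau>"
    using e by (simp add: R_def return_in_Delta actions_def)
  \<comment> \<open>Bundles the requirements on a conservative deviation for \<open>x\<close> so
    that one can be chosen for every allocation at once.\<close>
  define good where "good x D' \<longleftrightarrow> D' \<in> Delta ?\<tau> \<and>
      (\<forall>a\<in>profiles I. expect D' (\<lambda>a'. utility I M i ((others I i a)(i := a')))
         \<ge> ereal (lam * ?v x - mu * T x (others I i a))) \<and>
      (\<forall>a'\<in>dist_supp ?\<tau> D'. \<forall>b\<in>other_profiles I i. payment M (b(i := a')) i \<le> ?v x)" for x D'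
  have "\<exists>D'. good x D'" if "x \<in> allocs I i" for x
    using assms(8) that unfolding conservatively_smooth_def good_def by blast
  then obtain K0 where K0: "\<And>x. x \<in> allocs I i \<Longrightarrow> good x (K0 x)"
    by metis
  \<comment> \<open>The mixture lemmas ask for a member of \<open>Delta\<close> at every
    \<open>x\<close> of the type. The default \<open>R\<close> sits only outside
    \<open>allocs I i\<close>, where \<xi> has no mass.\<close>
  define K where "K x = (if x \<in> allocs I i then K0 x else R)" for x
  have K: "K x \<in> Delta ?\<tau>" for x
    using K0 R by (simp add: K_def good_def)
  define D1 where "D1 = measure_pmf \<xi> \<bind> K"
  have D1: "D1 \<in> Delta ?\<tau>"
    unfolding D1_def by (rule bind_pmf_in_Delta) (rule K)
  define V where "V = (\<integral>x. ?v x \<partial>\<xi>)"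
  have "0 \<le> V"
    unfolding V_def using supp v_nonneg by (intro integral_nonneg_AE) (auto simp: AE_measure_pmf_iff)
  moreover have "0 < budget I i"
    using inst i by (simp add: is_instance_def)
  ultimately obtain q where q: "0 \<le> q" "q \<le> 1" and "min (ereal V) (budget I i) = ereal (q * V)"
    by (rule min_ereal_eq_scaled)
  then have lv: "liquid_value I i \<xi> = ereal (q * V)" and qB: "ereal (q * V) \<le> budget I i"
    by (simp_all add: liquid_value_def V_def[symmetric] flip: \<open>min _ _ = _\<close>)
  define N where "N t = (if t then D1 else R)" for t
  have N: "N t \<in> Delta ?\<tau>" for t
    using D1 R by (simp add: N_def)
  \<comment> \<open>A Bernoulli coin with bias \<open>q\<close> decides between \<open>D1\<close>
    and opting out, so the mixture lemmas apply a second time. \<open>D\<close> is fixed before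
    \<open>a\<close>, since one deviation must serve all profiles.\<close>
  define D where "D = measure_pmf (bernoulli_pmf q) \<bind> N"
  have D: "D \<in> Delta ?\<tau>"
    unfolding D_def by (rule bind_pmf_in_Delta) (rule N)
  have "D \<in> budget_feasible_actions I M i (others I i a) \<and>
      expect D (\<lambda>a'. utility I M i ((others I i a)(i := a')))
        \<ge> ereal lam * liquid_value I i \<xi> - ereal (mu * (\<integral>x. T x (others I i a) \<partial>\<xi>))"
    if a: "a \<in> profiles I" for a
  proof -
    define b where "b = others I i a"
    have b: "b \<in> other_profiles I i"
      unfolding b_def using a by (rule others_in_other_profiles)
    let ?p = "\<lambda>a'. payment M (b(i := a')) i" and ?u = "\<lambda>a'. utility I M i (b(i := a'))"
    note p_meas = payment_measurable[OF mech i b] and u_meas = utility_measurable[OF mech i b]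
    have K_pay: "?p a' \<le> ?v x" if "x \<in> set_pmf \<xi>" "a' \<in> dist_supp ?\<tau> (K x)" for x a'
      using K0 that supp b by (auto simp: K_def good_def)
    note K_bounds = inst mech i b K K_pay
    note p_int_K = integrable_payment[OF K_bounds] and p_le_K = integral_payment_le[OF K_bounds]
      and u_int_K = integrable_utility[OF K_bounds]
    \<comment> \<open>The smoothness guarantee is stated with \<open>expect\<close>; bounded
      payments make the utility integrable, which turns it into a real inequality that can be
      averaged over \<xi>.\<close>
    have u_K: "lam * ?v x - mu * T x b \<le> (\<integral>a'. ?u a' \<partial>K x)" if "x \<in> set_pmf \<xi>" for x
    proof -
      have "ereal (lam * ?v x - mu * T x b) \<le> expect (K x) ?u"
        using K0 supp a that by (auto simp: K_def b_def good_def)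
      then show ?thesis
        by (simp add: expect_eq_integral[OF u_int_K[OF that]])
    qed
    have p_int_D1: "integrable D1 ?p" and u_int_D1: "integrable D1 ?u"
      unfolding D1_def
      using integrable_bind_pmf[of K, OF K fin p_meas p_int_K]
        integrable_bind_pmf[of K, OF K fin u_meas u_int_K]
      by simp_all
    \<comment> \<open>Given \<open>x\<close>, the payment is at most \<open>?v x\<close>; averaging
      these bounds over \<xi> gives \<open>V\<close>.\<close>
    have p_D1: "(\<integral>a'. ?p a' \<partial>D1) \<le> V"
    proof -
      have "(\<integral>a'. ?p a' \<partial>D1) = (\<integral>x. (\<integral>a'. ?p a' \<partial>K x) \<partial>\<xi>)"
        unfolding D1_def by (rule integral_bind_pmf[of K, OF K fin p_meas p_int_K])
      also have "\<dots> \<le> V"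
        unfolding V_def using fin p_le_K
        by (intro integral_mono_AE integrable_measure_pmf_finite) (auto simp: AE_measure_pmf_iff)
      finally show ?thesis .
    qed
    have u_D1: "lam * V - mu * (\<integral>x. T x b \<partial>\<xi>) \<le> (\<integral>a'. ?u a' \<partial>D1)"
    proof -
      have "lam * V - mu * (\<integral>x. T x b \<partial>\<xi>) = (\<integral>x. lam * ?v x - mu * T x b \<partial>\<xi>)"
        unfolding V_def using fin by (simp add: integrable_measure_pmf_finite)
      also have "\<dots> \<le> (\<integral>x. (\<integral>a'. ?u a' \<partial>K x) \<partial>\<xi>)"
        using fin u_K
        by (intro integral_mono_AE integrable_measure_pmf_finite) (auto simp: AE_measure_pmf_iff)
      also have "\<dots> = (\<integral>a'. ?u a' \<partial>D1)"
        unfolding D1_def by (rule integral_bind_pmf[of K, OF K fin u_meas u_int_K, symmetric])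
      finally show ?thesis .
    qed
    have e_space: "e \<in> space (borel_sigma ?\<tau>)"
      using e by (simp add: actions_def)
    have p_int_R: "integrable R ?p" and u_int_R: "integrable R ?u"
      unfolding R_def using e_space p_meas u_meas
      by (auto simp: integrable_iff_bounded nn_integral_return)
    \<comment> \<open>With zero payment the utility is the valuation of an allocation in
      \<open>allocs I i\<close>, hence nonnegative.\<close>
    have p_R: "(\<integral>a'. ?p a' \<partial>R) = 0" and u_R: "(\<integral>a'. ?u a' \<partial>R) \<ge> 0"
    proof -
      show "(\<integral>a'. ?p a' \<partial>R) = 0"
        unfolding R_def using e_pay[OF b] by (simp add: integral_return[OF e_space p_meas])
      have "b(i := e) \<in> profiles I"
        using fun_upd_in_profiles[OF i b e] .
      then have "outcome M (b(i := e)) i \<in> allocs I i"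
        using mech inst i by (auto simp: is_mechanism_def is_instance_def)
      then show "(\<integral>a'. ?u a' \<partial>R) \<ge> 0"
        unfolding R_def using e_pay[OF b] v_nonneg
        by (subst integral_return[OF e_space u_meas]) (simp add: utility_def)
    qed
    have p_int_N: "integrable (N t) ?p" and u_int_N: "integrable (N t) ?u" for t
      using p_int_D1 p_int_R u_int_D1 u_int_R by (simp_all add: N_def)
    have p_int: "integrable D ?p" and u_int: "integrable D ?u"
      unfolding D_def
      using integrable_bind_pmf[of N _ "bernoulli_pmf q", OF N _ p_meas p_int_N]
        integrable_bind_pmf[of N _ "bernoulli_pmf q", OF N _ u_meas u_int_N]
      by simp_all
    have "(\<integral>a'. ?p a' \<partial>D) = (\<integral>t. (\<integral>a'. ?p a' \<partial>N t) \<partial>bernoulli_pmf q)"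
      unfolding D_def by (rule integral_bind_pmf[of N _ "bernoulli_pmf q", OF N _ p_meas p_int_N]) simp
    \<comment> \<open>Only the \<open>D1\<close> branch pays. By the choice of \<open>q\<close>, the
      bound \<open>q * V\<close> is the smaller of \<open>V\<close> and the budget.\<close>
    also have "\<dots> \<le> q * V"
      using q p_R mult_left_mono[OF p_D1 q(1)] by (simp add: N_def mult.commute)
    finally have "expect D ?p \<le> budget I i"
      using qB by (simp add: expect_eq_integral[OF p_int]) (meson ereal_less_eq(3) order_trans)
    moreover have "lam * (q * V) - mu * (\<integral>x. T x b \<partial>\<xi>) \<le> (\<integral>a'. ?u a' \<partial>D)"
    proof -
      have "0 \<le> (\<integral>x. T x b \<partial>\<xi>)"
        using assms(4) supp b
        by (intro integral_nonneg_AE) (auto simp: AE_measure_pmf_iff is_threshold_def)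
      \<comment> \<open>Scaling \<open>u_D1\<close> by \<open>q\<close> leaves the threshold term
        scaled too; restoring its full weight only lowers the guarantee, because the term is
        nonnegative and subtracted.\<close>
      then have "q * (mu * (\<integral>x. T x b \<partial>\<xi>)) \<le> mu * (\<integral>x. T x b \<partial>\<xi>)"
        using q \<open>mu \<ge> 0\<close> by (intro mult_left_le_one_le) auto
      moreover have "q * (lam * V - mu * (\<integral>x. T x b \<partial>\<xi>)) \<le> q * (\<integral>a'. ?u a' \<partial>D1)"
        using u_D1 q by (intro mult_left_mono)
      moreover have "0 \<le> (1 - q) * (\<integral>a'. ?u a' \<partial>R)"
        using q u_R by simp
      moreover have "(\<integral>a'. ?u a' \<partial>D) = (\<integral>t. (\<integral>a'. ?u a' \<partial>N t) \<partial>bernoulli_pmf q)"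
        unfolding D_def by (rule integral_bind_pmf[of N _ "bernoulli_pmf q", OF N _ u_meas u_int_N]) simp
      moreover have "\<dots> = q * (\<integral>a'. ?u a' \<partial>D1) + (1 - q) * (\<integral>a'. ?u a' \<partial>R)"
        using q by (simp add: N_def mult.commute)
      ultimately show ?thesis
        by (simp add: algebra_simps)
    qed
    ultimately show ?thesis
      using D by (simp add: budget_feasible_actions_def lv expect_eq_integral[OF u_int] b_def[symmetric])
  qed
  then show ?thesis
    using D unfolding budget_feasible_smooth_def \<xi>_def by blast
qed

end
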